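(* Let $N\ge1$, let $\mathfrak q=(\mathfrak q_{ij})_{i,j=1}^{2N}$ be the matrix with entries $$\mathfrak q_{ij}=\int_0^1x^{i+j-2}(1-x)\,dx=[(i+j)(i+j-1)]^{-1},$$ and let $\mathfrak Q=\mathfrak q^{-1}$. Then $\mathfrak Q$ is an even integer matrix: $\mathfrak Q\in 2M_{2N}(\mathbb{Z})$.
   Context: $M_{2N}(\mathbb{Z})$ denotes the ring of $2N\times 2N$ integer matrices. *)

theory Defs
  imports "HOL-Analysis.Analysis" "Jordan_Normal_Form.Matrix"
begin

text \<open>
  Rows and columns of a matrix are numbered from 0 in \<^typ>\<open>real mat\<close>, so the entry at
  position \<open>(i, j)\<close> is \<open>q_entry (i + 1) (j + 1)\<close>.
\<close>

definition q_entry :: "nat \<Rightarrow> nat \<Rightarrow> real" where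
  "q_entry i j = integral {0..1} (\<lambda>x. x ^ (i + j - 2) * (1 - x))"

definition q_mat :: "nat \<Rightarrow> real mat" where
  "q_mat N = Matrix.mat (2 * N) (2 * N) (\<lambda>(i, j). q_entry (i + 1) (j + 1))"

definition even_int_mats :: "nat \<Rightarrow> real mat set" where
  "even_int_mats n = (\<lambda>M :: int mat. 2 \<cdot>\<^sub>m map_mat real_of_int M) ` carrier_mat n n"

end

theory Submission
  imports Defs "Jordan_Normal_Form.Determinant"
begin

text \<open>
  The matrix \<open>q\<close> is the Gram matrix of the monomials \<open>1, x, x^2, ...\<close> for the weight \<open>1 - x\<close> on
  \<open>[0, 1]\<close>.  The orthogonal polynomials of this weight are the shifted Jacobi polynomials
  \<open>p_k(x) = \<Sum>i. (-1)^i (k choose i) (k + 1 + i choose i) x^i\<close>.  They have integer coefficients, and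
  the square of the norm of \<open>p_k\<close> is \<open>1 / (2 (k + 1))\<close>.  So if the rows of \<open>L\<close> are the coefficient
  vectors of the \<open>p_k\<close>, then \<open>L q L\<^sup>T\<close> is the diagonal matrix with entries \<open>1 / (2 (k + 1))\<close>, and
  \<open>q\<^sup>-\<^sup>1 = L\<^sup>T diag(2 (k + 1)) L\<close> is twice an integer matrix.

  Orthogonality and norm both follow from the closed form of the moments
  \<open>\<integral> x^m p_k(x) (1 - x) dx\<close> in lemma \<open>jacobi_moment\<close>, which is proved by induction on \<open>k\<close>:
  the recurrence in \<open>k\<close> comes from a telescoping (Zeilberger) identity between the summands, lemma
  \<open>jacobi_telescope\<close>.
\<close>

section \<open>The entries of the matrix and the Jacobi coefficients\<close>

text \<open>
  The coefficient of \<open>x^i\<close> in the \<open>k\<close>-th shifted Jacobi polynomial for the weight \<open>1 - x\<close>,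
  normalised to have the value \<open>1\<close> at \<open>0\<close>.  It vanishes for \<open>i > k\<close>.
\<close>

definition jacobi_coeff :: "nat \<Rightarrow> nat \<Rightarrow> int" where
  "jacobi_coeff k i = (-1) ^ i * int (k choose i) * int ((k + 1 + i) choose i)"

lemma jacobi_coeff_eq_0: "k < i \<Longrightarrow> jacobi_coeff k i = 0"
  by (simp add: jacobi_coeff_def)

lemma q_entry_eq:
  assumes "i \<ge> 1" "j \<ge> 1"
  shows "q_entry i j = inverse ((real i + real j) * (real i + real j - 1))"
proof -
  obtain p where p: "i + j = p + 2"
    using assms by (metis add_mono le_Suc_ex one_add_one add.commute)
  have antideriv: "((\<lambda>x::real. x ^ Suc r / real (Suc r)) has_real_derivative x ^ r) (at x within S)"
    for r x S
    using DERIV_cdivide[OF DERIV_pow[of "Suc r" x S], of "real (Suc r)"] by simp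
  have "((\<lambda>x::real. x ^ p - x ^ (p + 1)) has_integral
          (1 ^ Suc p / real (Suc p) - 1 ^ Suc (p + 1) / real (Suc (p + 1)))
        - (0 ^ Suc p / real (Suc p) - 0 ^ Suc (p + 1) / real (Suc (p + 1)))) {0..1}"
    by (rule fundamental_theorem_of_calculus)
      (simp, unfold has_real_derivative_iff_has_vector_derivative[symmetric],
        rule DERIV_diff[OF antideriv antideriv])
  then have "integral {0..1} (\<lambda>x::real. x ^ p - x ^ (p + 1)) =
      1 / real (p + 1) - 1 / real (p + 2)"
    by (simp add: integral_unique)
  moreover have "(\<lambda>x::real. x ^ (i + j - 2) * (1 - x)) = (\<lambda>x. x ^ p - x ^ (p + 1))"
    using p by (auto simp: algebra_simps)
  ultimately have "q_entry i j = 1 / real (p + 1) - 1 / real (p + 2)"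
    by (simp add: q_entry_def)
  also have "\<dots> = inverse (real (p + 2) * (real (p + 2) - 1))"
    by (simp add: field_simps)
  also have "real (p + 2) = real i + real j"
    using p by (metis of_nat_add)
  finally show ?thesis .
qed

section \<open>Moments of the Jacobi polynomials\<close>

text \<open>
  The rational identity to which the telescoping identity below reduces once all its binomial
  coefficients are expressed by \<open>A = (k + 1 choose i)\<close> and \<open>B = (k + 1 + i choose i)\<close>;
  \<open>x\<close>, \<open>y\<close>, \<open>z\<close> and \<open>s\<close> stand for \<open>k\<close>, \<open>m\<close>, \<open>i\<close> and \<open>(-1)^i\<close>.
\<close>

lemma telescope_identity:
  fixes x y z s A B :: real
  assumes nz: "x + 1 \<noteq> 0" "x + 2 \<noteq> 0" "z + y + 1 \<noteq> 0" "z + y + 2 \<noteq> 0"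
  shows "(x + 1) * (y + x + 3) * (s * A * (B * (x + 2 + z) / (x + 2)) / ((z + y + 1) * (z + y + 2)))
    + (y - x) * (x + 2) * (s * ((x + 1 - z) * A / (x + 1)) * B / ((z + y + 1) * (z + y + 2)))
   = ((2 * x + 3) / ((x + 2) * (x + 1))) * (s * (A * (x + 1 - z)) * (B * (x + 2 + z)) / (z + y + 2))
    - (- ((2 * x + 3) / ((x + 2) * (x + 1))) * (s * z\<^sup>2 * A * B / (z + y + 1)))"
    (is "?l1 + ?l2 = ?r1 - ?r2")
proof -
  define a b c d where "a = x + 1" and "b = x + 2" and "c = z + y + 1" and "d = z + y + 2"
  define D where "D = s * A * B / (a * b * c * d)"
  have nz': "a \<noteq> 0" "b \<noteq> 0" "c \<noteq> 0" "d \<noteq> 0" using nz by (simp_all add: a_def b_def c_def d_def)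
  have "?l1 = D * (a\<^sup>2 * (y + x + 3) * (x + 2 + z))"
    unfolding D_def a_def[symmetric] b_def[symmetric] c_def[symmetric] d_def[symmetric]
    using nz' by (simp add: power2_eq_square)
  moreover have "?l2 = D * ((y - x) * b\<^sup>2 * (x + 1 - z))"
    unfolding D_def a_def[symmetric] b_def[symmetric] c_def[symmetric] d_def[symmetric]
    using nz' by (simp add: power2_eq_square)
  moreover have "?r1 = D * ((2 * x + 3) * (x + 1 - z) * (x + 2 + z) * c)"
    unfolding D_def a_def[symmetric] b_def[symmetric] c_def[symmetric] d_def[symmetric]
    using nz' by (simp add: mult_ac)
  moreover have "?r2 = - D * ((2 * x + 3) * z\<^sup>2 * d)"
    unfolding D_def a_def[symmetric] b_def[symmetric] c_def[symmetric] d_def[symmetric]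
    using nz' by (simp add: mult_ac)
  moreover have "a\<^sup>2 * (y + x + 3) * (x + 2 + z) + (y - x) * b\<^sup>2 * (x + 1 - z)
      = (2 * x + 3) * (x + 1 - z) * (x + 2 + z) * c + (2 * x + 3) * z\<^sup>2 * d"
    unfolding a_def b_def c_def d_def by (simp add: algebra_simps power2_eq_square)
  ultimately show ?thesis
    by (simp only: distrib_left[symmetric] minus_mult_left[symmetric] diff_minus_eq_add)
qed

text \<open>
  A telescoping identity between the summands of the \<open>m\<close>-th moments of two consecutive Jacobi
  polynomials.  The certificate \<open>G\<close>, in the sense of Zeilberger's algorithm, vanishes at \<open>i = 0\<close> because of
  the factor \<open>i^2\<close>, and at all \<open>i > k + 1\<close> because of the binomial coefficient.  So summation
  over \<open>i\<close> gives a recurrence of order one in \<open>k\<close> for the moments.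
\<close>

lemma jacobi_telescope:
  fixes k m i :: nat
  defines "F \<equiv> \<lambda>k i. real_of_int (jacobi_coeff k i) / ((real i + real m + 1) * (real i + real m + 2))"
  defines "G \<equiv> \<lambda>i. - ((2 * real k + 3) / ((real k + 2) * (real k + 1))) *
             ((-1) ^ i * (real i)\<^sup>2 * real ((k + 1) choose i) * real ((k + 1 + i) choose i)
               / (real i + real m + 1))"
  shows "(real k + 1) * (real m + real k + 3) * F (k + 1) i + (real m - real k) * (real k + 2) * F k i
         = G (Suc i) - G i"
proof -
  define x y z where "x = real k" and "y = real m" and "z = real i"
  define A B s where "A = real ((k + 1) choose i)" and "B = real ((k + 1 + i) choose i)"
    and "s = (-1 :: real) ^ i"
  have pos: "x \<ge> 0" "y \<ge> 0" "z \<ge> 0"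
    by (auto simp: x_def y_def z_def)
  have k_i: "real (k choose i) = (x + 1 - z) * A / (x + 1)"
  proof (cases "i \<le> k + 1")
    case True
    have "(k + 1) * (k choose i) = (k + 1 - i) * ((k + 1) choose i)"
      using binomial_absorb_comp[of "k + 1" i] by simp
    from arg_cong[OF this, of real] have "(real k + 1) * real (k choose i) = real (k + 1 - i) * A"
      by (simp only: A_def of_nat_mult of_nat_add of_nat_1)
    then show ?thesis
      using True pos by (simp add: x_def z_def of_nat_diff field_simps)
  qed (simp add: A_def binomial_eq_0)
  have B1: "real ((k + 1 + 1 + i) choose i) = B * (x + 2 + z) / (x + 2)"
  proof -
    have "(k + 2 + i) * ((k + 1 + i) choose i) = (k + 2) * ((k + 2 + i) choose i)"
      using binomial_absorb_comp[of "k + 2 + i" i] by simp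
    from arg_cong[OF this, of real]
    have "(real k + 2 + real i) * B = (real k + 2) * real ((k + 2 + i) choose i)"
      by (simp only: B_def of_nat_mult of_nat_add of_nat_numeral)
    then show ?thesis
      using pos by (simp add: x_def z_def field_simps)
  qed
  have A_Suc: "real ((k + 1) choose Suc i) = A * (x + 1 - z) / (z + 1)"
  proof -
    define c where "c = real ((k + 1) choose Suc i)"
    have "real (Suc i) * c = (real k + 1) * real (k choose i)"
      using arg_cong[OF binomial_absorption[of i "k + 1"], of real]
      by (simp only: c_def of_nat_mult of_nat_add of_nat_1 add_diff_cancel_right')
    then have "(z + 1) * c = A * (x + 1 - z)"
      using pos unfolding k_i by (simp add: x_def z_def add_ac mult_ac)
    then show ?thesis
      using pos unfolding c_def[symmetric] by (simp add: field_simps)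
  qed
  have B_Suc: "real ((k + 1 + Suc i) choose Suc i) = B * (x + 2 + z) / (z + 1)"
  proof -
    define c where "c = real ((k + 1 + Suc i) choose Suc i)"
    have eqs: "k + 2 + i - 1 = k + 1 + i" "k + 1 + Suc i = k + 2 + i"
      by simp_all
    have "Suc i * ((k + 2 + i) choose Suc i) = (k + 2 + i) * ((k + 1 + i) choose i)"
      using binomial_absorption[of i "k + 2 + i"] by (simp only: eqs)
    from arg_cong[OF this, of real] have "real (Suc i) * c = (real k + 2 + real i) * B"
      by (simp only: c_def B_def eqs of_nat_mult of_nat_add of_nat_numeral)
    then have "(z + 1) * c = B * (x + 2 + z)"
      by (simp add: x_def z_def add_ac mult_ac)
    then show ?thesis
      using pos unfolding c_def[symmetric] by (simp add: field_simps)
  qed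
  have F1: "F (k + 1) i = s * A * (B * (x + 2 + z) / (x + 2)) / ((z + y + 1) * (z + y + 2))"
    unfolding F_def jacobi_coeff_def
    by (simp only: of_int_mult of_int_power of_int_minus of_int_1 of_int_of_nat_eq B1 A_def s_def y_def z_def)
  have F0: "F k i = s * ((x + 1 - z) * A / (x + 1)) * B / ((z + y + 1) * (z + y + 2))"
    unfolding F_def jacobi_coeff_def
    by (simp only: of_int_mult of_int_power of_int_minus of_int_1 of_int_of_nat_eq k_i B_def s_def y_def z_def)
  have G1: "G (Suc i) = ((2 * x + 3) / ((x + 2) * (x + 1))) *
      (s * (z + 1)\<^sup>2 * (A * (x + 1 - z) / (z + 1)) * (B * (x + 2 + z) / (z + 1)) / (z + y + 2))"
    unfolding G_def A_Suc B_Suc by (simp add: x_def y_def z_def s_def add_ac)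
  have G0: "G i = - ((2 * x + 3) / ((x + 2) * (x + 1))) * (s * z\<^sup>2 * A * B / (z + y + 1))"
    by (simp only: G_def x_def y_def z_def s_def A_def B_def)
  have G1': "G (Suc i) = ((2 * x + 3) / ((x + 2) * (x + 1))) *
      (s * (A * (x + 1 - z)) * (B * (x + 2 + z)) / (z + y + 2))"
    using pos unfolding G1 by (simp add: power2_eq_square)
  have nz: "x + 1 \<noteq> 0" "x + 2 \<noteq> 0" "z + y + 1 \<noteq> 0" "z + y + 2 \<noteq> 0"
    using pos by auto
  show ?thesis
    unfolding F1 F0 G1' G0 x_def[symmetric] y_def[symmetric]
    by (rule telescope_identity[OF nz])
qed

text \<open>
  The left-hand side is \<open>\<integral> x^m p_k(x) (1 - x) dx\<close>; the summation range may be any \<open>{..<n}\<close> that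
  contains all the exponents \<open>0, ..., k\<close>.  The right-hand side vanishes for \<open>m < k\<close>, which is the
  orthogonality of \<open>p_k\<close> to all polynomials of lower degree.
\<close>

lemma jacobi_moment:
  assumes "k < n"
  shows "(\<Sum>i<n. real_of_int (jacobi_coeff k i) / ((real i + real m + 1) * (real i + real m + 2)))
         = (-1) ^ k * real (m choose k) * fact m * fact (k + 1) / fact (m + k + 2)"
  using assms
proof (induction k)
  case 0
  have "(\<Sum>i<n. real_of_int (jacobi_coeff 0 i) / ((real i + real m + 1) * (real i + real m + 2)))
      = (\<Sum>i\<in>{0}. real_of_int (jacobi_coeff 0 i) / ((real i + real m + 1) * (real i + real m + 2)))"
    using 0 by (intro sum.mono_neutral_right) (auto simp: jacobi_coeff_eq_0)
  then show ?case
    by (simp add: jacobi_coeff_def add_ac)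
next
  case (Suc k)
  define S where "S = (\<lambda>k. \<Sum>i<n. real_of_int (jacobi_coeff k i)
                              / ((real i + real m + 1) * (real i + real m + 2)))"
  have IH: "S k = (-1) ^ k * real (m choose k) * fact m * fact (k + 1) / fact (m + k + 2)"
    using Suc by (simp add: S_def)
  define G where "G = (\<lambda>i. - ((2 * real k + 3) / ((real k + 2) * (real k + 1))) *
             ((-1) ^ i * (real i)\<^sup>2 * real ((k + 1) choose i) * real ((k + 1 + i) choose i)
               / (real i + real m + 1)))"
  have "(real k + 1) * (real m + real k + 3) * S (k + 1) + (real m - real k) * (real k + 2) * S k
      = (\<Sum>i<n. G (Suc i) - G i)"
    unfolding S_def sum_distrib_left sum.distrib[symmetric] jacobi_telescope G_def ..
  also have "\<dots> = G n - G 0"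
    by (rule sum_lessThan_telescope)
  also have "\<dots> = 0"
    using Suc.prems by (simp add: G_def binomial_eq_0)
  finally have "(real k + 1) * (real m + real k + 3) * S (k + 1)
      + (real m - real k) * (real k + 2) * S k = 0" .
  then have "S (k + 1) * ((real k + 1) * (real m + real k + 3)) = - (real m - real k) * (real k + 2) * S k"
    by (simp add: algebra_simps)
  moreover have "(real k + 1) * (real m + real k + 3) \<noteq> 0"
    by (simp add: add_nonneg_eq_0_iff)
  ultimately have rec: "S (k + 1) = - (real m - real k) * (real k + 2) * S k
                              / ((real k + 1) * (real m + real k + 3))"
    by (metis nonzero_eq_divide_eq)
  have bin: "(real k + 1) * real (m choose Suc k) = (real m - real k) * real (m choose k)"
  proof (cases "k \<le> m")
    case True
    have "Suc k * (m choose Suc k) = (m - k) * (m choose k)"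
      by (rule trans[OF binomial_absorption binomial_absorb_comp[symmetric]])
    from arg_cong[OF this, of real]
    have "real (Suc k) * real (m choose Suc k) = real (m - k) * real (m choose k)"
      by (simp only: of_nat_mult)
    then show ?thesis
      using True by (simp add: of_nat_diff add_ac)
  qed (simp add: binomial_eq_0)
  have bin': "real (m choose Suc k) = (real m - real k) * real (m choose k) / (real k + 1)"
    using bin by (simp add: field_simps)
  have f1: "fact (Suc k + 1) = (real k + 2) * fact (k + 1)"
    by (simp add: algebra_simps)
  have f2: "fact (m + Suc k + 2) = (real m + real k + 3) * fact (m + k + 2)"
    by (simp add: algebra_simps)
  have arrange: "- a * b * (p * C * f * g / h) / (c * d) = - 1 * p * (a * C / c) * f * (b * g) / (d * h)"
    for a b c d p C f g h :: real
    by (simp add: mult_ac)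
  have "S (Suc k) = (-1) ^ Suc k * real (m choose Suc k) * fact m * fact (Suc k + 1) / fact (m + Suc k + 2)"
    unfolding bin' f1 f2 power_Suc arrange[symmetric] using rec[unfolded IH] by (simp only: Suc_eq_plus1)
  then show ?case
    by (simp only: S_def)
qed

section \<open>Orthogonality and norms\<close>

text \<open>
  Orthogonality in terms of coefficients: the left-hand side is
  \<open>\<integral> p_k(x) p_l(x) (1 - x) dx\<close>.
\<close>

lemma jacobi_orthogonal:
  assumes "k < n" "l < n"
  shows "(\<Sum>j<n. (\<Sum>i<n. real_of_int (jacobi_coeff k i) / ((real i + real j + 1) * (real i + real j + 2)))
            * real_of_int (jacobi_coeff l j)) =
         (if k = l then 1 / (2 * (real k + 1)) else 0)"
proof -
  define g where "g = (\<lambda>i j. 1 / ((real i + real j + 1) * (real i + real j + 2)))"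
  have g_sym: "g i j = g j i" for i j
    by (simp add: g_def add_ac)
  define H where "H = (\<lambda>k l. \<Sum>j<n. (\<Sum>i<n. real_of_int (jacobi_coeff k i) * g i j)
                              * real_of_int (jacobi_coeff l j))"
  have moment: "(\<Sum>i<n. real_of_int (jacobi_coeff k i) * g i m)
      = (-1) ^ k * real (m choose k) * fact m * fact (k + 1) / fact (m + k + 2)" if "k < n" for k m
    using jacobi_moment[OF that, of m] by (simp add: g_def)
  \<comment> \<open>Each term with \<open>j < k\<close> has a vanishing moment, and each term with \<open>j \<ge> k > l\<close> a vanishing coefficient.\<close>
  have less: "H k l = 0" if "l < k" "k < n" for k l
  proof -
    have "(\<Sum>i<n. real_of_int (jacobi_coeff k i) * g i j) * real_of_int (jacobi_coeff l j) = 0" for j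
      using that by (cases "j < k") (auto simp: moment jacobi_coeff_eq_0)
    then show ?thesis
      unfolding H_def by (intro sum.neutral ballI)
  qed
  have sym: "H k l = H l k" for k l
  proof -
    have "H k l = (\<Sum>j<n. \<Sum>i<n. real_of_int (jacobi_coeff k i) * g i j * real_of_int (jacobi_coeff l j))"
      by (simp add: H_def sum_distrib_right)
    also have "\<dots> = (\<Sum>i<n. \<Sum>j<n. real_of_int (jacobi_coeff k i) * g i j * real_of_int (jacobi_coeff l j))"
      by (rule sum.swap)
    also have "\<dots> = H l k"
      unfolding H_def sum_distrib_right by (intro sum.cong refl) (simp add: g_sym mult_ac)
    finally show ?thesis .
  qed
  have diag: "H k k = 1 / (2 * (real k + 1))" if "k < n" for k
  proof -
    have "H k k = (\<Sum>j\<in>{k}. (\<Sum>i<n. real_of_int (jacobi_coeff k i) * g i j) * real_of_int (jacobi_coeff k j))"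
      unfolding H_def
    proof (rule sum.mono_neutral_right)
      show "\<forall>j\<in>{..<n} - {k}. (\<Sum>i<n. real_of_int (jacobi_coeff k i) * g i j) * real_of_int (jacobi_coeff k j) = 0"
      proof
        fix j assume "j \<in> {..<n} - {k}"
        then show "(\<Sum>i<n. real_of_int (jacobi_coeff k i) * g i j) * real_of_int (jacobi_coeff k j) = 0"
          using that by (cases "j < k") (auto simp: moment jacobi_coeff_eq_0)
      qed
    qed (use that in auto)
    also have "\<dots> = (\<Sum>i<n. real_of_int (jacobi_coeff k i) * g i k) * real_of_int (jacobi_coeff k k)"
      by simp
    also have "\<dots> = (-1) ^ k * fact k * fact (k + 1) / fact (k + k + 2)
                      * ((-1) ^ k * real ((k + 1 + k) choose k))"
      unfolding moment[OF that] by (simp add: jacobi_coeff_def)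
    also have "\<dots> = fact k * fact (k + 1) * real ((k + 1 + k) choose k) / fact (k + k + 2)"
      by (simp flip: power_mult_distrib)
    also have "real ((k + 1 + k) choose k) = fact (k + 1 + k) / (fact k * fact (k + 1))"
      by (simp add: binomial_fact)
    also have "fact k * fact (k + 1) * (fact (k + 1 + k) / (fact k * fact (k + 1))) / fact (k + k + 2)
        = (fact (k + 1 + k) :: real) / fact (k + k + 2)"
      by simp
    also have "(fact (k + k + 2) :: real) = (2 * (real k + 1)) * fact (k + 1 + k)"
      by (simp add: algebra_simps)
    finally show ?thesis
      by simp
  qed
  have "H k l = (if k = l then 1 / (2 * (real k + 1)) else 0)"
    using less[of l k] less[of k l] sym[of k l] diag[of k] assms by (cases k l rule: linorder_cases) auto
  then show ?thesis
    by (simp add: H_def g_def)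
qed

section \<open>The inverse matrix\<close>

text \<open>
  The inverse of \<open>q\<close> in the form \<open>L\<^sup>T diag(2 (k + 1)) L\<close>, where \<open>L\<close> is the matrix of the Jacobi
  coefficients.
\<close>

lemma q_mat_inverse:
  obtains M :: "int mat"
  where "M \<in> carrier_mat (2 * N) (2 * N)"
    and "q_mat N * (2 \<cdot>\<^sub>m map_mat real_of_int M) = 1\<^sub>m (2 * N)"
    and "(2 \<cdot>\<^sub>m map_mat real_of_int M) * q_mat N = 1\<^sub>m (2 * N)"
proof -
  define n where "n = 2 * N"
  define M :: "int mat" where
    "M = Matrix.mat n n (\<lambda>(i, j). \<Sum>k<n. (int k + 1) * jacobi_coeff k i * jacobi_coeff k j)"
  \<comment> \<open>\<open>W\<close> is \<open>diag(2 (k + 1)) L\<close>, and \<open>T\<close> is the transpose of \<open>L\<close>.\<close>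
  define W :: "real mat" where
    "W = Matrix.mat n n (\<lambda>(k, i). 2 * (real k + 1) * real_of_int (jacobi_coeff k i))"
  define T :: "real mat" where
    "T = Matrix.mat n n (\<lambda>(j, l). real_of_int (jacobi_coeff l j))"
  have carr: "W \<in> carrier_mat n n" "T \<in> carrier_mat n n" "q_mat N \<in> carrier_mat n n"
    "M \<in> carrier_mat n n"
    by (auto simp: W_def T_def q_mat_def n_def M_def)
  have q: "q_mat N = Matrix.mat n n (\<lambda>(i, j). 1 / ((real i + real j + 1) * (real i + real j + 2)))"
    unfolding q_mat_def n_def[symmetric]
    by (rule cong_mat) (auto simp: q_entry_eq field_simps)
  have Wq: "W * q_mat N = Matrix.mat n n (\<lambda>(k, j). 2 * (real k + 1) *
      (\<Sum>i<n. real_of_int (jacobi_coeff k i) / ((real i + real j + 1) * (real i + real j + 2))))"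
    unfolding q W_def
    by (rule eq_matI) (auto simp: scalar_prod_def sum_distrib_left atLeast0LessThan mult_ac)
  have "W * q_mat N * T = 1\<^sub>m n"
  proof (rule eq_matI)
    fix k l assume "k < dim_row (1\<^sub>m n :: real mat)" "l < dim_col (1\<^sub>m n :: real mat)"
    then have kl: "k < n" "l < n" by auto
    define S where "S = (\<lambda>j. \<Sum>i<n. real_of_int (jacobi_coeff k i)
                                / ((real i + real j + 1) * (real i + real j + 2)))"
    have "(W * q_mat N) $$ (k, j) = 2 * (real k + 1) * S j" if "j < n" for j
      unfolding Wq S_def using kl that by simp
    then have "(W * q_mat N * T) $$ (k, l)
        = (\<Sum>j<n. 2 * (real k + 1) * S j * real_of_int (jacobi_coeff l j))"
      using kl carr by (simp add: scalar_prod_def atLeast0LessThan T_def)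
    also have "\<dots> = 2 * (real k + 1) * (\<Sum>j<n. S j * real_of_int (jacobi_coeff l j))"
      by (simp only: sum_distrib_left mult.assoc)
    also have "\<dots> = 1\<^sub>m n $$ (k, l)"
      unfolding S_def jacobi_orthogonal[OF kl] using kl by simp
    finally show "(W * q_mat N * T) $$ (k, l) = 1\<^sub>m n $$ (k, l)" .
  qed (auto simp: W_def T_def)
  \<comment> \<open>A one-sided inverse of a square matrix is two-sided, so the factor \<open>T\<close> can be moved to the left.\<close>
  then have "T * (W * q_mat N) = 1\<^sub>m n"
    using carr by (intro mat_mult_left_right_inverse[of "W * q_mat N" n T]) auto
  then have left: "T * W * q_mat N = 1\<^sub>m n"
    using carr by (simp add: assoc_mult_mat[of T n n W n "q_mat N" n])
  then have right: "q_mat N * (T * W) = 1\<^sub>m n"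
    using carr by (intro mat_mult_left_right_inverse[of "T * W" n "q_mat N"]) auto
  have TW: "T * W = 2 \<cdot>\<^sub>m map_mat real_of_int M"
    unfolding T_def W_def M_def
    by (rule eq_matI) (auto simp: scalar_prod_def sum_distrib_left atLeast0LessThan mult_ac intro!: sum.cong)
  show ?thesis
    using that[of M] carr(4) left right unfolding TW n_def by blast
qed

theorem theorem13:
  fixes N :: nat
  assumes "N \<ge> 1"
  shows "(\<forall>i\<in>{1..2 * N}. \<forall>j\<in>{1..2 * N}.
            q_entry i j = inverse ((real i + real j) * (real i + real j - 1)))
       \<and> invertible_mat (q_mat N)
       \<and> (\<forall>Q. inverts_mat (q_mat N) Q \<and> inverts_mat Q (q_mat N)
            \<longrightarrow> Q \<in> even_int_mats (2 * N))"
proof (intro conjI ballI allI impI)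
  fix i j assume "i \<in> {1..2 * N}" "j \<in> {1..2 * N}"
  then show "q_entry i j = inverse ((real i + real j) * (real i + real j - 1))"
    by (intro q_entry_eq) auto
next
  obtain M :: "int mat" where M: "M \<in> carrier_mat (2 * N) (2 * N)"
    and right: "q_mat N * (2 \<cdot>\<^sub>m map_mat real_of_int M) = 1\<^sub>m (2 * N)"
    and left: "(2 \<cdot>\<^sub>m map_mat real_of_int M) * q_mat N = 1\<^sub>m (2 * N)"
    by (rule q_mat_inverse)
  have q: "q_mat N \<in> carrier_mat (2 * N) (2 * N)"
    by (simp add: q_mat_def)
  show "invertible_mat (q_mat N)"
    unfolding invertible_mat_def inverts_mat_def using q M left right
    by (intro conjI exI[of _ "2 \<cdot>\<^sub>m map_mat real_of_int M"]) auto
  fix Q assume Q: "inverts_mat (q_mat N) Q \<and> inverts_mat Q (q_mat N)"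
  then have qQ: "q_mat N * Q = 1\<^sub>m (2 * N)" and Qq: "Q * q_mat N = 1\<^sub>m (dim_row Q)"
    using q by (auto simp: inverts_mat_def)
  have Q_carr: "Q \<in> carrier_mat (2 * N) (2 * N)"
    using arg_cong[OF qQ, of dim_col] arg_cong[OF Qq, of dim_col] q by auto
  let ?R = "2 \<cdot>\<^sub>m map_mat real_of_int M"
  have R: "?R \<in> carrier_mat (2 * N) (2 * N)"
    using M by auto
  have "Q = ?R * q_mat N * Q"
    using left Q_carr by simp
  also have "\<dots> = ?R * (q_mat N * Q)"
    by (rule assoc_mult_mat[OF R q Q_carr])
  also have "\<dots> = ?R"
    unfolding qQ using R by (rule right_mult_one_mat)
  finally show "Q \<in> even_int_mats (2 * N)"
    unfolding even_int_mats_def using M by blast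
qed

end
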